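(* There exist absolute constants $c_0,\varepsilon_0>0$ with the following property. For every $0<\varepsilon\le\varepsilon_0$ and every sufficiently large integer $n$, there is a point cloud $X_n\subset B_1(0)$ with $$s_n:=|X_n|=n^6,\qquad\delta_{X_n}=n^{-4},$$ and a wavenumber $$\kappa_n=\varepsilon n^6$$ such that $$\kappa_n\delta_{X_n}=\varepsilon n^2=\varepsilon s_n^{1/3},$$ whereas the associated spherical Gram matrix (formed with $\kappa=\kappa_n$) satisfies $$\lambda_{\max}(G_{X_n})\ge\frac{c_0}{\varepsilon}.$$ Consequently, an arbitrary-cloud spherical frame upper bound cannot hold under a separation threshold $o(s^{1/3})$.
   Context: A point cloud is a finite set $X=\{x_1,\dots,x_s\}$ of $s$ distinct points in $\mathbb R^3$; $B_1(0)\subset\mathbb R^3$ is the unit ball centred at the origin. Its minimum separation is $\delta_X=\min_{j\ne k}|x_j-x_k|$. For a wavenumber $\kappa>0$, the spherical Gram matrix is $G_X=[K_\kappa(x_j-x_k)]_{j,k=1}^s$ with $K_\kappa(h)=\frac1{4\pi}\int_{\mathbb S^2}e^{i\kappa\omega\cdot h}\,d\omega=\frac{\sin(\kappa|h|)}{\kappa|h|}$, $K_\kappa(0)=1$, and $\lambda_{\max}(G_X)$ is its largest eigenvalue. For $\alpha\in\mathbb C^s$, $\frac1{4\pi}\int_{\mathbb S^2}\bigl|\sum_{j=1}^s\alpha_je^{i\kappa\omega\cdot x_j}\bigr|^2d\omega=\alpha^*G_X\alpha$. A spherical frame upper bound is a uniform upper bound on this quantity by a constant times $\|\alpha\|_2^2$,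 equivalently a uniform upper bound on $\lambda_{\max}(G_X)$; "arbitrary-cloud" means for arbitrary $s$-point clouds in $B_1(0)$, and a "separation threshold" is a lower bound imposed on $\kappa\delta_X$ in terms of $s$. *)

theory Defs
  imports
    "HOL-Analysis.Analysis"
    "HOL-Library.Landau_Symbols"
    "Jordan_Normal_Form.Char_Poly"
begin

text \<open>
  Unnormalised surface measure on the unit sphere of \<open>\<real>\<^sup>3\<close>, realised as a Borel measure on the
  ambient space by the cone formula: the area of \<open>A\<close> is three times the volume of the cone
  \<open>{x. norm x < 1 \<and> x / norm x \<in> A}\<close>.  Since \<open>sgn x = x /\<^sub>R norm x\<close>, it is
  concentrated on \<open>sphere 0 1\<close>; the null set \<open>{0}\<close>, which \<open>sgn\<close> fixes, is irrelevant.
\<close>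
definition sphere_measure :: "(real ^ 3) measure" where
  "sphere_measure = distr (density lborel (\<lambda>x. 3 * indicator (ball 0 1) x)) borel sgn"

lemma emeasure_sphere_measure_UNIV: "emeasure sphere_measure UNIV = ennreal (4 * pi)"
proof -
  have [measurable]: "(sgn :: real ^ 3 \<Rightarrow> real ^ 3) \<in> borel_measurable borel"
    unfolding sgn_div_norm [abs_def] by measurable
  have [measurable]: "(\<lambda>x :: real ^ 3. 3 * indicator (ball 0 1) x :: ennreal) \<in> borel_measurable borel"
    by (intro borel_measurable_times_ennreal borel_measurable_const borel_measurable_indicator) simp
  have "emeasure sphere_measure UNIV =
      (\<integral>\<^sup>+x. 3 * indicator (ball 0 1) (x :: real ^ 3) \<partial>lborel)"
    unfolding sphere_measure_def
    by (subst emeasure_distr, simp, simp, subst emeasure_density) (auto simp: field_simps)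
  also have "\<dots> = 3 * emeasure lborel (ball (0 :: real ^ 3) 1)"
    by (simp add: nn_integral_cmult_indicator)
  also have "\<dots> = 3 * ennreal (4 / 3 * pi)"
    by (simp add: emeasure_ball unit_ball_vol_3)
  also have "\<dots> = ennreal (4 * pi)"
    by (simp flip: ennreal_numeral ennreal_mult)
  finally show ?thesis .
qed

lemma AE_sphere_measure: "AE \<omega> in sphere_measure. \<omega> \<in> sphere 0 1"
proof -
  have [measurable]: "(sgn :: real ^ 3 \<Rightarrow> real ^ 3) \<in> borel_measurable borel"
    unfolding sgn_div_norm [abs_def] by measurable
  have [measurable]: "(\<lambda>x :: real ^ 3. 3 * indicator (ball 0 1) x :: ennreal) \<in> borel_measurable borel"
    by (intro borel_measurable_times_ennreal borel_measurable_const borel_measurable_indicator) simp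
  have "AE x in lborel. sgn (x :: real ^ 3) \<in> sphere 0 1"
    using AE_lborel_singleton [of "0 :: real ^ 3"] by eventually_elim (simp add: norm_sgn)
  then show ?thesis
    unfolding sphere_measure_def
    by (subst AE_distr_iff, simp, simp, subst AE_density) (simp, auto)
qed

definition sphere_kernel :: "real \<Rightarrow> real ^ 3 \<Rightarrow> complex" where
  "sphere_kernel \<kappa> h =
     1 / (4 * pi) * (LINT \<omega>|sphere_measure. exp (\<i> * complex_of_real (\<kappa> * (\<omega> \<bullet> h))))"

text \<open>A point cloud is given by an enumeration without repetition.\<close>
definition point_cloud :: "(real ^ 3) list \<Rightarrow> bool" where
  "point_cloud xs \<longleftrightarrow> distinct xs \<and> set xs \<subseteq> ball 0 1"

text \<open>Meaningful only for clouds with at least two points.\<close>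
definition separation :: "(real ^ 3) list \<Rightarrow> real" where
  "separation xs = Min {norm (xs ! j - xs ! k) |j k. j < length xs \<and> k < length xs \<and> j \<noteq> k}"

definition spherical_gram :: "real \<Rightarrow> (real ^ 3) list \<Rightarrow> complex mat" where
  "spherical_gram \<kappa> xs =
     mat (length xs) (length xs) (\<lambda>(j, k). sphere_kernel \<kappa> (xs ! j - xs ! k))"

text \<open>
  Used for Hermitian matrices of positive size, all of whose eigenvalues are real, so that the set
  below is the whole spectrum; it is finite and nonempty.
\<close>
definition lambda_max :: "complex mat \<Rightarrow> real" where
  "lambda_max A = Max {r. eigenvalue A (complex_of_real r)}"

definition spherical_energy :: "real \<Rightarrow> (real ^ 3) list \<Rightarrow> complex Matrix.vec \<Rightarrow> real" where
  "spherical_energy \<kappa> xs \<alpha> =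
     1 / (4 * pi) * (LINT \<omega>|sphere_measure.
       (cmod (\<Sum>j<length xs. vec_index \<alpha> j * exp (\<i> * complex_of_real (\<kappa> * (\<omega> \<bullet> xs ! j)))))\<^sup>2)"

text \<open>
  The upper frame bound with constant \<open>C\<close> for all clouds whose scaled separation reaches the
  threshold \<open>\<tau> s\<close> depending on the number \<open>s\<close> of points.  Clouds with fewer than two points have no
  separation and are left out.
\<close>
definition arbitrary_cloud_frame_upper_bound :: "(nat \<Rightarrow> real) \<Rightarrow> real \<Rightarrow> bool" where
  "arbitrary_cloud_frame_upper_bound \<tau> C \<longleftrightarrow>
     (\<forall>xs \<kappa>. point_cloud xs \<and> 2 \<le> length xs \<and> 0 < \<kappa> \<and> \<tau> (length xs) \<le> \<kappa> * separation xs \<longrightarrow>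
        (\<forall>\<alpha> \<in> carrier_vec (length xs).
           spherical_energy \<kappa> xs \<alpha> \<le> C * (\<Sum>j<length xs. (cmod (vec_index \<alpha> j))\<^sup>2)))"

end

theory Submission
  imports Defs "Jordan_Normal_Form.Spectral_Radius"
begin

text \<open>
  The cloud is an \<open>n \<times> n \<times> n^4\<close> grid of spacing \<open>1/n^4\<close>: a needle of height \<open>1\<close> and width \<open>1/n^3\<close>
  along the third axis.  For \<open>\<omega>\<close> in a cap of radius \<open>t\<close> about the pole the phase \<open>\<kappa> (\<omega> \<bullet> x - x$3)\<close>
  is at most of order \<open>\<kappa> (t/n^3 + t^2)\<close>, hence bounded when \<open>t\<close> is a small multiple of
  \<open>1 / sqrt \<kappa>\<close>.  With the modulation \<open>\<alpha> = exp (-\<i> \<kappa> x$3)\<close> all \<open>s\<close> terms therefore add up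
  coherently on the cap, whose area is of order \<open>t^2 \<sim> 1 / (\<epsilon> s)\<close>, and the energy is at least of
  order \<open>s^2 t^2 \<sim> s / \<epsilon>\<close>.
\<close>

subsection \<open>Rayleigh quotients of Hermitian matrices\<close>

lemma scalar_prod_conjugate_self:
  fixes w :: "complex Matrix.vec"
  shows "w \<bullet>c w = complex_of_real (\<Sum>i<dim_vec w. (cmod (vec_index w i))\<^sup>2)"
  by (simp add: scalar_prod_def atLeast0LessThan flip: complex_norm_square)

lemma cmod_scalar_prod_conjugate_le:
  fixes v w :: "complex Matrix.vec"
  assumes "v \<in> carrier_vec n" "w \<in> carrier_vec n"
  shows "(cmod (v \<bullet>c w))\<^sup>2 \<le>
    (\<Sum>i<n. (cmod (vec_index v i))\<^sup>2) * (\<Sum>i<n. (cmod (vec_index w i))\<^sup>2)"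
proof -
  have "cmod (v \<bullet>c w) \<le> (\<Sum>i<n. cmod (vec_index v i) * cmod (vec_index w i))"
    using assms by (auto simp: scalar_prod_def atLeast0LessThan norm_mult intro!: order_trans[OF norm_sum])
  then have "(cmod (v \<bullet>c w))\<^sup>2 \<le> (\<Sum>i<n. cmod (vec_index v i) * cmod (vec_index w i))\<^sup>2"
    by (rule power_mono) simp
  also have "\<dots> \<le> (\<Sum>i<n. (cmod (vec_index v i))\<^sup>2) * (\<Sum>i<n. (cmod (vec_index w i))\<^sup>2)"
    by (rule Cauchy_Schwarz_ineq_sum)
  finally show ?thesis .
qed

lemma index_mult_mat_vec_sum:
  assumes "M \<in> carrier_mat m n" "v \<in> carrier_vec n" "i < m"
  shows "vec_index (M *\<^sub>v v) i = (\<Sum>j<n. M $$ (i, j) * vec_index v j)"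
  using assms by (auto simp: scalar_prod_def atLeast0LessThan intro!: sum.cong)

lemma sesquilinear_form_sum:
  fixes M :: "complex mat"
  assumes "M \<in> carrier_mat m n" "v \<in> carrier_vec n" "w \<in> carrier_vec m"
  shows "(M *\<^sub>v v) \<bullet>c w = (\<Sum>i<m. \<Sum>j<n. M $$ (i, j) * vec_index v j * cnj (vec_index w i))"
proof -
  have "(M *\<^sub>v v) \<bullet>c w = (\<Sum>i<m. vec_index (M *\<^sub>v v) i * cnj (vec_index w i))"
    using assms by (auto simp: scalar_prod_def atLeast0LessThan simp del: index_mult_mat_vec)
  also have "\<dots> = (\<Sum>i<m. \<Sum>j<n. M $$ (i, j) * vec_index v j * cnj (vec_index w i))"
    using assms by (intro sum.cong refl)
      (simp add: index_mult_mat_vec_sum sum_distrib_right del: index_mult_mat_vec)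
  finally show ?thesis .
qed

text \<open>Symmetry is required entry by entry, the form in which \<open>cnj_sphere_kernel\<close>
  supplies it for the Gram matrix.\<close>

locale hermitian_mat =
  fixes A :: "complex mat" and n :: nat
  assumes carrier [simp]: "A \<in> carrier_mat n n"
    and hermitian: "\<And>i j. i < n \<Longrightarrow> j < n \<Longrightarrow> A $$ (i, j) = cnj (A $$ (j, i))"
begin

lemma dims [simp]: "dim_row A = n" "dim_col A = n"
  by (rule carrier_matD[OF carrier])+

lemma self_adjoint:
  assumes "v \<in> carrier_vec n" "w \<in> carrier_vec n"
  shows "(A *\<^sub>v v) \<bullet>c w = v \<bullet>c (A *\<^sub>v w)"
proof -
  have "(A *\<^sub>v v) \<bullet>c w =
      (\<Sum>i<n. \<Sum>j<n. A $$ (i, j) * vec_index v j * cnj (vec_index w i))"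
    by (rule sesquilinear_form_sum[OF carrier assms])
  also have "\<dots> = (\<Sum>j<n. \<Sum>i<n. A $$ (i, j) * vec_index v j * cnj (vec_index w i))"
    by (rule sum.swap)
  also have "\<dots> = (\<Sum>j<n. \<Sum>i<n. cnj (A $$ (j, i)) * vec_index v j * cnj (vec_index w i))"
    by (intro sum.cong refl) (metis hermitian lessThan_iff)
  also have "\<dots> = (\<Sum>j<n. vec_index v j * cnj (vec_index (A *\<^sub>v w) j))"
    using assms by (intro sum.cong refl)
      (simp add: index_mult_mat_vec_sum[OF carrier] sum_distrib_left mult_ac del: index_mult_mat_vec)
  also have "\<dots> = v \<bullet>c (A *\<^sub>v w)"
    by (simp add: scalar_prod_def atLeast0LessThan)
  finally show ?thesis .
qed

lemma pow_mat_add: "A ^\<^sub>m (k + l) = A ^\<^sub>m k * A ^\<^sub>m l"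
proof (induction l)
  case (Suc l)
  then show ?case
    using carrier by (simp add: assoc_mult_mat[of _ n n _ n _ n] pow_carrier_mat)
qed simp

lemma pow_self_adjoint:
  assumes "v \<in> carrier_vec n" "w \<in> carrier_vec n"
  shows "(A ^\<^sub>m k *\<^sub>v v) \<bullet>c w = v \<bullet>c (A ^\<^sub>m k *\<^sub>v w)"
  using assms
proof (induction k arbitrary: v w)
  case (Suc k)
  \<comment> \<open>\<open>A ^\<^sub>m Suc k\<close> unfolds with the new factor on the right, but
    moving the factors across the product one at a time leaves it on the left.\<close>
  have comm: "A * A ^\<^sub>m k = A ^\<^sub>m k * A"
    using pow_mat_add[of 1 k] by simp
  have P: "A ^\<^sub>m k \<in> carrier_mat n n" by simp
  have "(A ^\<^sub>m Suc k *\<^sub>v v) \<bullet>c w = (A ^\<^sub>m k *\<^sub>v (A *\<^sub>v v)) \<bullet>c w"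
    using Suc.prems by (simp add: assoc_mult_mat_vec[OF P carrier])
  also have "\<dots> = v \<bullet>c (A *\<^sub>v (A ^\<^sub>m k *\<^sub>v w))"
    using Suc by (simp add: self_adjoint mult_mat_vec_carrier[OF carrier] mult_mat_vec_carrier[OF P])
  also have "\<dots> = v \<bullet>c (A ^\<^sub>m Suc k *\<^sub>v w)"
    using Suc.prems by (simp add: assoc_mult_mat_vec[OF carrier P, symmetric] comm)
  finally show ?case .
qed simp

text \<open>Iterates \<open>\<langle>A^k v, v\<rangle>\<^sup>2 \<le> \<parallel>A^k v\<parallel>\<^sup>2 \<parallel>v\<parallel>\<^sup>2 = \<langle>A^(2k) v, v\<rangle> \<parallel>v\<parallel>\<^sup>2\<close>, so no diagonalisation of \<open>A\<close> is needed.\<close>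
lemma moment_growth:
  assumes v: "v \<in> carrier_vec n" and "0 \<le> q"
    and q: "q * (\<Sum>i<n. (cmod (vec_index v i))\<^sup>2) \<le> Re ((A *\<^sub>v v) \<bullet>c v)"
  shows "q ^ (2 ^ k) * (\<Sum>i<n. (cmod (vec_index v i))\<^sup>2) \<le> Re ((A ^\<^sub>m (2 ^ k) *\<^sub>v v) \<bullet>c v)"
\<comment> \<open>The induction cancels a factor \<open>V\<close>, so the degenerate case is split
  off; there Cauchy-Schwarz makes the form vanish.\<close>
proof (cases "(\<Sum>i<n. (cmod (vec_index v i))\<^sup>2) = 0")
  case True
  have "(A ^\<^sub>m (2 ^ k) *\<^sub>v v) \<bullet>c v = 0"
    using cmod_scalar_prod_conjugate_le[of "A ^\<^sub>m (2 ^ k) *\<^sub>v v" n v] v True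
      mult_mat_vec_carrier[OF pow_carrier_mat[OF carrier] v, of "2 ^ k"] by simp
  then show ?thesis using True by simp
next
  case False
  define V where "V = (\<Sum>i<n. (cmod (vec_index v i))\<^sup>2)"
  have V: "V > 0" using False unfolding V_def by (simp add: sum_nonneg less_le)
  have "q ^ (2 ^ k) * V \<le> Re ((A ^\<^sub>m (2 ^ k) *\<^sub>v v) \<bullet>c v)"
  proof (induction k)
    case 0
    then show ?case using q carrier by (simp add: V_def)
  next
    case (Suc k)
    let ?P = "A ^\<^sub>m (2 ^ k)"
    have P: "?P \<in> carrier_mat n n" by simp
    have Pv: "?P *\<^sub>v v \<in> carrier_vec n" by (rule mult_mat_vec_carrier[OF P v])
    have "A ^\<^sub>m (2 ^ Suc k) = ?P * ?P"
      using pow_mat_add[of "2 ^ k" "2 ^ k"] by (simp add: mult_2)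
    then have "(A ^\<^sub>m (2 ^ Suc k) *\<^sub>v v) \<bullet>c v = (?P *\<^sub>v v) \<bullet>c (?P *\<^sub>v v)"
      using v Pv by (simp add: assoc_mult_mat_vec[OF P P] pow_self_adjoint)
    then have eq: "Re ((A ^\<^sub>m (2 ^ Suc k) *\<^sub>v v) \<bullet>c v) = (\<Sum>i<n. (cmod (vec_index (?P *\<^sub>v v) i))\<^sup>2)"
      using Pv by (simp only: scalar_prod_conjugate_self carrier_vecD Re_complex_of_real)
    have "(q ^ (2 ^ k) * V)\<^sup>2 \<le> (Re ((?P *\<^sub>v v) \<bullet>c v))\<^sup>2"
      using Suc \<open>0 \<le> q\<close> V by (intro power_mono) auto
    also have "\<dots> \<le> (cmod ((?P *\<^sub>v v) \<bullet>c v))\<^sup>2"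
      by (simp add: cmod_power2)
    also have "\<dots> \<le> Re ((A ^\<^sub>m (2 ^ Suc k) *\<^sub>v v) \<bullet>c v) * V"
      unfolding eq V_def by (rule cmod_scalar_prod_conjugate_le[OF Pv v])
    finally have "(q ^ (2 ^ Suc k) * V) * V \<le> Re ((A ^\<^sub>m (2 ^ Suc k) *\<^sub>v v) \<bullet>c v) * V"
      by (simp add: power2_eq_square power_mult_distrib mult_ac mult_2 power_add)
    then show ?case using V by (simp only: mult_le_cancel_right_pos)
  qed
  then show ?thesis by (simp add: V_def)
qed

text \<open>Were the quotient \<open>q\<close> above 1, \<open>moment_growth\<close> would force the
  forms of the powers \<open>A ^\<^sub>m (2 ^ k)\<close> to grow at least like q^(2^k). A spectral
  radius below 1 bounds the entries of all powers of \<open>A\<close> by one constant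
  \<open>c\<close>, hence all these forms by one constant \<open>S\<close>.\<close>

lemma rayleigh_le_of_spectral_radius_less_1:
  assumes v: "v \<in> carrier_vec n" and rho: "spectral_radius A < 1"
  shows "Re ((A *\<^sub>v v) \<bullet>c v) \<le> (\<Sum>i<n. (cmod (vec_index v i))\<^sup>2)"
proof (rule ccontr)
  define V where "V = (\<Sum>i<n. (cmod (vec_index v i))\<^sup>2)"
  assume "\<not> ?thesis"
  then have less: "V < Re ((A *\<^sub>v v) \<bullet>c v)" by (simp add: V_def)
  have "V \<noteq> 0"
  proof
    assume "V = 0"
    then have "(A *\<^sub>v v) \<bullet>c v = 0"
      using cmod_scalar_prod_conjugate_le[of "A *\<^sub>v v" n v] v
        mult_mat_vec_carrier[OF carrier v] by (simp add: V_def)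
    with less \<open>V = 0\<close> show False by simp
  qed
  then have V: "V > 0" unfolding V_def by (simp add: sum_nonneg less_le)
  define q where "q = Re ((A *\<^sub>v v) \<bullet>c v) / V"
  have q: "q > 1" using less V by (simp add: q_def)
  obtain c where c: "\<And>k. norm_bound (A ^\<^sub>m k) c"
    using spectral_radius_jnf_norm_bound_less_1_upper_triangular[OF carrier rho] by auto
  define S where "S = (\<Sum>i<n. \<Sum>j<n. c * cmod (vec_index v j) * cmod (vec_index v i))"
  have bound: "Re ((A ^\<^sub>m k *\<^sub>v v) \<bullet>c v) \<le> S" for k
  proof -
    have P: "A ^\<^sub>m k \<in> carrier_mat n n" by simp
    have "(A ^\<^sub>m k *\<^sub>v v) \<bullet>c v =
        (\<Sum>i<n. \<Sum>j<n. (A ^\<^sub>m k) $$ (i, j) * vec_index v j * cnj (vec_index v i))"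
      by (rule sesquilinear_form_sum[OF P v v])
    also have "cmod \<dots> \<le> S"
      unfolding S_def using c[of k] P
      by (auto simp: norm_mult norm_bound_def intro!: sum_norm_le mult_right_mono)
    finally show ?thesis using complex_Re_le_cmod order_trans by blast
  qed
  obtain m where m: "S / V < q ^ m" using real_arch_pow[OF q] by blast
  \<comment> \<open>Since m is at most 2^m, the Archimedean exponent can be replaced by a power of
    two, the only exponents that \<open>moment_growth\<close> covers.\<close>
  have "q ^ m \<le> q ^ (2 ^ m)" using q by (intro power_increasing) auto
  with m have "S / V < q ^ (2 ^ m)" by linarith
  then have "S < q ^ (2 ^ m) * V" using V by (simp add: field_simps)
  also have "\<dots> \<le> S"
    using moment_growth[OF v, of q m] q V bound[of "2 ^ m"] by (simp add: q_def V_def[symmetric])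
  finally show False by simp
qed

section \<open>From the spectral radius to the largest eigenvalue\<close>

lemma spectral_radius_nonneg:
  assumes "n > 0"
  shows "spectral_radius A \<ge> 0"
  using spectral_radius_mem_max(1)[OF carrier assms] by auto

text \<open>By scaling: for every r above the spectral radius, A/r has spectral radius below 1 and
  the preceding bound applies to it. Then r is brought down to the spectral radius.\<close>

lemma rayleigh_le_spectral_radius:
  assumes v: "v \<in> carrier_vec n" and "n > 0"
  shows "Re ((A *\<^sub>v v) \<bullet>c v) \<le> spectral_radius A * (\<Sum>i<n. (cmod (vec_index v i))\<^sup>2)"
proof -
  define V where "V = (\<Sum>i<n. (cmod (vec_index v i))\<^sup>2)"
  have V: "V \<ge> 0" unfolding V_def by (intro sum_nonneg) auto
  have *: "Re ((A *\<^sub>v v) \<bullet>c v) \<le> r * V" if r: "r > spectral_radius A" for r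
  proof -
    have r0: "r > 0" using r spectral_radius_nonneg[OF \<open>n > 0\<close>] by simp
    let ?c = "complex_of_real (1 / r)"
    have B: "?c \<cdot>\<^sub>m A \<in> carrier_mat n n" by simp
    have Bw: "(?c \<cdot>\<^sub>m A) *\<^sub>v w = ?c \<cdot>\<^sub>v (A *\<^sub>v w)" if "w \<in> carrier_vec n" for w
    proof (rule eq_vecI)
      fix i assume "i < dim_vec (?c \<cdot>\<^sub>v (A *\<^sub>v w))"
      then have i: "i < n" by simp
      have "vec_index ((?c \<cdot>\<^sub>m A) *\<^sub>v w) i = (\<Sum>j<n. ?c * (A $$ (i, j) * vec_index w j))"
        unfolding index_mult_mat_vec_sum[OF B that i] using i by (intro sum.cong) simp_all
      also have "\<dots> = ?c * vec_index (A *\<^sub>v w) i"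
        unfolding index_mult_mat_vec_sum[OF carrier that i] by (rule sum_distrib_left[symmetric])
      finally show "vec_index ((?c \<cdot>\<^sub>m A) *\<^sub>v w) i = vec_index (?c \<cdot>\<^sub>v (A *\<^sub>v w)) i"
        using i by simp
    qed simp
    interpret B: hermitian_mat "?c \<cdot>\<^sub>m A" n
    proof
      fix i j assume "i < n" "j < n"
      then show "(?c \<cdot>\<^sub>m A) $$ (i, j) = cnj ((?c \<cdot>\<^sub>m A) $$ (j, i))"
        using carrier hermitian[of i j] by simp
    qed (rule B)
    \<comment> \<open>An eigenvalue of A/r of largest modulus: r times it is an eigenvalue of
      \<open>A\<close>, so its own modulus is at most \<open>spectral_radius A\<close> / r <
      1.\<close>
    obtain \<mu> where \<mu>: "\<mu> \<in> spectrum (?c \<cdot>\<^sub>m A)" "cmod \<mu> = spectral_radius (?c \<cdot>\<^sub>m A)"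
      using spectral_radius_mem_max(1)[OF B \<open>n > 0\<close>] by force
    then obtain w where w: "w \<in> carrier_vec n" "w \<noteq> 0\<^sub>v n" "?c \<cdot>\<^sub>v (A *\<^sub>v w) = \<mu> \<cdot>\<^sub>v w"
      using Bw B unfolding spectrum_def eigenvalue_def eigenvector_def by auto
    have "A *\<^sub>v w = of_real r \<cdot>\<^sub>v (?c \<cdot>\<^sub>v (A *\<^sub>v w))"
      using r0 by (simp add: smult_smult_assoc)
    also have "\<dots> = (of_real r * \<mu>) \<cdot>\<^sub>v w"
      unfolding w(3) by (simp add: smult_smult_assoc)
    finally have "of_real r * \<mu> \<in> spectrum A"
      using w(1,2) carrier unfolding spectrum_def eigenvalue_def eigenvector_def by auto
    then have "cmod (of_real r * \<mu>) \<le> spectral_radius A"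
      using spectral_radius_mem_max(2)[OF carrier \<open>n > 0\<close>] by blast
    then have "r * cmod \<mu> \<le> spectral_radius A" using r0 by (simp add: norm_mult)
    then have "r * cmod \<mu> < r * 1" using r by linarith
    then have "cmod \<mu> < 1" using r0 by (simp only: mult_less_cancel_left_pos)
    then have "spectral_radius (?c \<cdot>\<^sub>m A) < 1" using \<mu>(2) by simp
    from B.rayleigh_le_of_spectral_radius_less_1[OF v this]
    have "Re (?c * ((A *\<^sub>v v) \<bullet>c v)) \<le> V"
      unfolding Bw[OF v] V_def using v by simp
    then have "Re ((A *\<^sub>v v) \<bullet>c v) / r \<le> V" by simp
    then show ?thesis using r0 by (simp add: field_simps)
  qed
  have "Re ((A *\<^sub>v v) \<bullet>c v) \<le> spectral_radius A * V + e" if "e > 0" for e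
  proof -
    \<comment> \<open>The summand 1 keeps the denominator positive when \<open>V\<close> is zero,
      and the excess e V / (V + 1) stays below \<open>e\<close>.\<close>
    have "Re ((A *\<^sub>v v) \<bullet>c v) \<le> (spectral_radius A + e / (V + 1)) * V"
      using V that by (intro *) simp
    also have "\<dots> \<le> spectral_radius A * V + e"
      using V that by (simp add: field_simps)
    finally show ?thesis .
  qed
  then show ?thesis unfolding V_def by (rule field_le_epsilon)
qed

text \<open>An eigenvalue of maximal modulus is real by self-adjointness and nonnegative by
  positivity of the form, so it equals its modulus.\<close>

lemma eigenvalue_spectral_radius:
  assumes psd: "\<And>w. w \<in> carrier_vec n \<Longrightarrow> 0 \<le> Re ((A *\<^sub>v w) \<bullet>c w)" and "n > 0"
  shows "eigenvalue A (complex_of_real (spectral_radius A))"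
proof -
  obtain \<mu> where \<mu>: "eigenvalue A \<mu>" "cmod \<mu> = spectral_radius A"
    using spectral_radius_mem_max(1)[OF carrier \<open>n > 0\<close>] unfolding spectrum_def by force
  then obtain w where w: "w \<in> carrier_vec n" "w \<noteq> 0\<^sub>v n" "A *\<^sub>v w = \<mu> \<cdot>\<^sub>v w"
    using carrier unfolding eigenvalue_def eigenvector_def by auto
  define W where "W = (\<Sum>i<n. (cmod (vec_index w i))\<^sup>2)"
  have W: "w \<bullet>c w = of_real W"
    using w(1) scalar_prod_conjugate_self[of w] by (simp add: W_def)
  have "w \<bullet>c w \<noteq> 0" using w conjugate_square_eq_0_vec by blast
  then have "W \<noteq> 0" using W by simp
  then have "W > 0" unfolding W_def by (simp add: sum_nonneg less_le)
  have "(A *\<^sub>v w) \<bullet>c w = \<mu> * W" using w(1) by (simp add: w(3) W)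
  moreover have "w \<bullet>c (A *\<^sub>v w) = cnj \<mu> * W"
    using w(1) by (simp add: w(3) W conjugate_smult_vec)
  ultimately have "\<mu> = cnj \<mu>"
    using self_adjoint[OF w(1) w(1)] \<open>W > 0\<close> by simp
  then have "\<mu> = of_real (Re \<mu>)" by (simp add: complex_eq_iff)
  moreover have "0 \<le> Re \<mu>"
    using psd[OF w(1)] \<open>(A *\<^sub>v w) \<bullet>c w = \<mu> * W\<close> \<open>W > 0\<close> by (simp add: zero_le_mult_iff)
  ultimately have "\<mu> = of_real (spectral_radius A)"
    by (metis \<mu>(2) abs_of_nonneg norm_of_real)
  then show ?thesis using \<mu>(1) by simp
qed

text \<open>Positivity places the spectral radius itself among the real eigenvalues over which
  \<open>lambda_max\<close> takes its maximum, so the bound by the spectral radius carries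
  over.\<close>

lemma rayleigh_le_lambda_max:
  assumes psd: "\<And>w. w \<in> carrier_vec n \<Longrightarrow> 0 \<le> Re ((A *\<^sub>v w) \<bullet>c w)"
    and v: "v \<in> carrier_vec n" and "n > 0"
  shows "Re ((A *\<^sub>v v) \<bullet>c v) \<le> lambda_max A * (\<Sum>i<n. (cmod (vec_index v i))\<^sup>2)"
proof -
  \<comment> \<open>Comparing a member with \<open>Max\<close> requires a finite set; finiteness of
    the spectrum is pulled back along the embedding of the reals.\<close>
  have "finite (complex_of_real ` {r. eigenvalue A (of_real r)})"
    using card_finite_spectrum(1)[OF carrier] by (rule finite_subset[rotated]) (auto simp: spectrum_def)
  then have "finite {r. eigenvalue A (complex_of_real r)}"
    by (rule finite_imageD) (simp add: inj_on_def)
  then have "spectral_radius A \<le> lambda_max A"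
    unfolding lambda_max_def using eigenvalue_spectral_radius[OF psd \<open>n > 0\<close>] by simp
  then have "spectral_radius A * (\<Sum>i<n. (cmod (vec_index v i))\<^sup>2)
      \<le> lambda_max A * (\<Sum>i<n. (cmod (vec_index v i))\<^sup>2)"
    by (intro mult_right_mono sum_nonneg) auto
  then show ?thesis using rayleigh_le_spectral_radius[OF v \<open>n > 0\<close>] by linarith
qed

end

subsection \<open>Coherent sums on a polar cap\<close>

lemma borel_measurable_sgn [measurable]: "(sgn :: real ^ 3 \<Rightarrow> real ^ 3) \<in> borel_measurable borel"
  unfolding sgn_div_norm [abs_def] by measurable

lemma sets_sphere_measure [measurable_cong, simp]: "sets sphere_measure = sets borel"
  and space_sphere_measure [simp]: "space sphere_measure = UNIV"
  by (simp_all add: sphere_measure_def)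

lemma finite_measure_sphere_measure: "finite_measure sphere_measure"
  by (rule finite_measureI) (simp add: emeasure_sphere_measure_UNIV)

lemma integrable_sphere_measure:
  fixes f :: "real ^ 3 \<Rightarrow> 'b :: {banach, second_countable_topology}"
  assumes "continuous_on UNIV f" "\<And>\<omega>. norm (f \<omega>) \<le> B"
  shows "integrable sphere_measure f"
proof (rule finite_measure.integrable_const_bound[OF finite_measure_sphere_measure])
  show "f \<in> borel_measurable sphere_measure"
    using borel_measurable_continuous_onI[OF assms(1)] by simp
  show "AE \<omega> in sphere_measure. norm (f \<omega>) \<le> B"
    by (simp add: assms(2))
qed

lemma integrable_sphere_exponential:
  "integrable sphere_measure (\<lambda>\<omega>. exp (\<i> * complex_of_real (\<kappa> * (\<omega> \<bullet> h))))"
  by (rule integrable_sphere_measure[where B = 1]) (auto intro!: continuous_intros)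

lemma power2_norm_3:
  fixes x :: "real ^ 3"
  shows "(norm x)\<^sup>2 = (x $ 1)\<^sup>2 + (x $ 2)\<^sup>2 + (x $ 3)\<^sup>2"
  unfolding power2_norm_eq_inner by (simp add: inner_vec_def sum_3 power2_eq_square)

text \<open>The sign condition excludes the antipodal cap, where \<omega> \<bullet> x is close to -
  x$3 instead of x$3.\<close>

definition polar_cap :: "real \<Rightarrow> (real ^ 3) set" where
  "polar_cap t = {\<omega>. norm \<omega> = 1 \<and> \<bar>\<omega> $ 1\<bar> \<le> t \<and> \<bar>\<omega> $ 2\<bar> \<le> t \<and> 0 \<le> \<omega> $ 3}"

lemma polar_cap_measurable [measurable]: "polar_cap t \<in> sets borel"
  unfolding polar_cap_def
  by (intro borel_closed closed_Collect_conj closed_Collect_eq closed_Collect_le continuous_intros)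

text \<open>The cone over the cap contains the box [-t/4, t/4]^2 x [1/4, 1/2] of volume t^2/16, and
  surface measure is three times cone volume. Points of the box have norm at least 1/4, so
  normalising them leaves the lateral coordinates at most t.\<close>

lemma measure_polar_cap_ge:
  assumes "0 < t" "t \<le> 1"
  shows "3 * t\<^sup>2 / 16 \<le> measure sphere_measure (polar_cap t)"
proof -
  define a b :: "real ^ 3" where "a = vector [- t / 4, - t / 4, 1 / 4]" and "b = vector [t / 4, t / 4, 1 / 2]"
  have mem: "x \<in> cbox a b \<longleftrightarrow> \<bar>x $ 1\<bar> \<le> t / 4 \<and> \<bar>x $ 2\<bar> \<le> t / 4 \<and> 1 / 4 \<le> x $ 3 \<and> x $ 3 \<le> 1 / 2" for x
    by (auto simp: mem_box_cart forall_3 a_def b_def)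
  \<comment> \<open>The product formula holds for nonempty boxes; (0, 0, 1/4) is the
    witness.\<close>
  have "measure lborel (cbox a b) = (\<Prod>i\<in>UNIV. b $ i - a $ i)"
    using mem[of "vector [0, 0, 1 / 4]"] assms by (intro content_cbox_cart) auto
  also have "\<dots> = t\<^sup>2 / 16"
    unfolding UNIV_3 by (simp add: a_def b_def power2_eq_square)
  finally have vol: "emeasure lborel (cbox a b) = ennreal (t\<^sup>2 / 16)"
    using emeasure_eq_ennreal_measure[of lborel "cbox a b"] emeasure_lborel_cbox_finite[of a b]
    by (metis infinity_ennreal_def less_irrefl)
  have sub: "x \<in> ball 0 1 \<and> sgn x \<in> polar_cap t" if "x \<in> cbox a b" for x
  proof -
    have x: "\<bar>x $ 1\<bar> \<le> t / 4" "\<bar>x $ 2\<bar> \<le> t / 4" "1 / 4 \<le> x $ 3" "x $ 3 \<le> 1 / 2"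
      using that by (simp_all add: mem)
    note power2_norm_3[of x]
    also have "(x $ 1)\<^sup>2 + (x $ 2)\<^sup>2 + (x $ 3)\<^sup>2 \<le> (1 / 4)\<^sup>2 + (1 / 4)\<^sup>2 + (1 / 2)\<^sup>2"
      using x assms by (intro add_mono abs_le_square_iff[THEN iffD1]) auto
    also have "\<dots> < 1\<^sup>2" by (simp add: power2_eq_square)
    finally have "norm x < 1" by (rule power2_less_imp_less) simp
    moreover have n: "1 / 4 \<le> norm x"
      using component_le_norm_cart[of x 3] x(3) by linarith
    moreover have "t / 4 \<le> t * norm x" using n assms by simp
    then have "\<bar>x $ 1\<bar> \<le> t * norm x" "\<bar>x $ 2\<bar> \<le> t * norm x" using x by linarith+
    moreover have "norm x > 0" using n by linarith
    ultimately show ?thesis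
      using x(3) by (auto simp: polar_cap_def sgn_div_norm norm_sgn abs_mult field_simps)
  qed
  have "ennreal (3 * t\<^sup>2 / 16) = 3 * emeasure lborel (cbox a b)"
    by (simp add: vol flip: ennreal_numeral ennreal_mult)
  also have "\<dots> = (\<integral>\<^sup>+x. 3 * indicator (cbox a b) x \<partial>lborel)"
    by (simp add: nn_integral_cmult_indicator)
  also have "\<dots> \<le> (\<integral>\<^sup>+x. 3 * indicator (ball 0 1) x * indicator (sgn -` polar_cap t) x \<partial>lborel)"
    using sub by (intro nn_integral_mono) (auto split: split_indicator)
  also have "\<dots> = emeasure sphere_measure (polar_cap t)"
  proof -
    have [measurable]: "(\<lambda>x :: real ^ 3. 3 * indicator (ball 0 1) x :: ennreal) \<in> borel_measurable borel"
      by (intro borel_measurable_times_ennreal borel_measurable_const borel_measurable_indicator) simp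
    have "sgn -` polar_cap t \<in> sets borel"
      using measurable_sets[OF borel_measurable_sgn polar_cap_measurable] by simp
    then show ?thesis
      unfolding sphere_measure_def
      by (subst emeasure_distr, simp, simp, subst emeasure_density) auto
  qed
  also have "\<dots> = ennreal (measure sphere_measure (polar_cap t))"
    by (rule finite_measure.emeasure_eq_measure[OF finite_measure_sphere_measure])
  finally show ?thesis by simp
qed

lemma half_le_cos:
  assumes "\<bar>x :: real\<bar> \<le> 1"
  shows "1 / 2 \<le> cos x"
proof -
  have "cos (pi / 3) \<le> cos \<bar>x\<bar>"
    using assms pi_gt3 by (intro cos_monotone_0_pi_le) auto
  then show ?thesis by (simp add: cos_60)
qed

text \<open>Each lateral coordinate contributes at most t \<rho>. The axial error is of second
  order: as \<omega>$3 lies in [0, 1], 1 - \<omega>$3 \<le> 1 - (\<omega>$3)^2 \<le> 2 t^2, and the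
  factor x$3 halves this.\<close>

lemma polar_cap_phase_le:
  fixes x \<omega> :: "real ^ 3"
  assumes "\<omega> \<in> polar_cap t" "0 \<le> \<rho>" "\<bar>x $ 1\<bar> \<le> \<rho>" "\<bar>x $ 2\<bar> \<le> \<rho>" "\<bar>x $ 3\<bar> \<le> 1 / 2"
  shows "\<bar>\<omega> \<bullet> x - x $ 3\<bar> \<le> 2 * t * \<rho> + t\<^sup>2"
proof -
  have \<omega>: "norm \<omega> = 1" "\<bar>\<omega> $ 1\<bar> \<le> t" "\<bar>\<omega> $ 2\<bar> \<le> t" "0 \<le> \<omega> $ 3"
    using assms by (simp_all add: polar_cap_def)
  have "t \<ge> 0" using \<omega> by linarith
  have le1: "\<omega> $ 3 \<le> 1" using component_le_norm_cart[of \<omega> 3] \<omega> by simp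
  have "(\<omega> $ 1)\<^sup>2 + (\<omega> $ 2)\<^sup>2 + (\<omega> $ 3)\<^sup>2 = (norm \<omega>)\<^sup>2"
    by (simp add: power2_norm_3)
  moreover have "(\<omega> $ 1)\<^sup>2 \<le> t\<^sup>2" "(\<omega> $ 2)\<^sup>2 \<le> t\<^sup>2"
    using \<omega> \<open>t \<ge> 0\<close> by (simp_all flip: abs_le_square_iff)
  moreover have "(\<omega> $ 3)\<^sup>2 \<le> \<omega> $ 3"
    using mult_left_le[OF le1 \<omega>(4)] by (simp add: power2_eq_square)
  ultimately have "\<bar>1 - \<omega> $ 3\<bar> \<le> 2 * t\<^sup>2" using le1 \<omega>(1) by simp
  then have "\<bar>1 - \<omega> $ 3\<bar> * \<bar>x $ 3\<bar> \<le> 2 * t\<^sup>2 * (1 / 2)"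
    using assms(5) by (intro mult_mono) auto
  moreover have "\<bar>\<omega> $ 1\<bar> * \<bar>x $ 1\<bar> \<le> t * \<rho>" "\<bar>\<omega> $ 2\<bar> * \<bar>x $ 2\<bar> \<le> t * \<rho>"
    using assms \<omega> \<open>t \<ge> 0\<close> by (auto intro!: mult_mono)
  moreover have "\<omega> \<bullet> x - x $ 3 = \<omega> $ 1 * x $ 1 + \<omega> $ 2 * x $ 2 - (1 - \<omega> $ 3) * x $ 3"
    by (simp add: inner_vec_def sum_3 algebra_simps)
  then have "\<bar>\<omega> \<bullet> x - x $ 3\<bar> \<le> \<bar>\<omega> $ 1\<bar> * \<bar>x $ 1\<bar> + \<bar>\<omega> $ 2\<bar> * \<bar>x $ 2\<bar> + \<bar>1 - \<omega> $ 3\<bar> * \<bar>x $ 3\<bar>"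
    unfolding abs_mult[symmetric] by linarith
  ultimately show ?thesis by linarith
qed

definition modulated :: "real \<Rightarrow> (real ^ 3) list \<Rightarrow> complex Matrix.vec" where
  "modulated \<kappa> xs = Matrix.vec (length xs) (\<lambda>j. exp (- \<i> * complex_of_real (\<kappa> * (xs ! j) $ 3)))"

text \<open>On the cap every modulated phase has absolute value at most 1, so each term has real
  part at least 1/2 and the sum has modulus at least s/2. Discarding the rest of the sphere leaves
  1/(4 pi) times 3 t^2/16 times s^2/4.\<close>

lemma spherical_energy_modulated_ge:
  fixes xs :: "(real ^ 3) list"
  assumes xs: "\<And>x. x \<in> set xs \<Longrightarrow> \<bar>x $ 1\<bar> \<le> \<rho> \<and> \<bar>x $ 2\<bar> \<le> \<rho> \<and> \<bar>x $ 3\<bar> \<le> 1 / 2"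
    and "0 \<le> \<rho>" "0 < t" "t \<le> 1" "0 \<le> \<kappa>" and phase: "\<kappa> * (2 * t * \<rho> + t\<^sup>2) \<le> 1"
  shows "3 * t\<^sup>2 * real (length xs) ^ 2 / (256 * pi) \<le> spherical_energy \<kappa> xs (modulated \<kappa> xs)"
proof -
  define s where "s = length xs"
  define F where "F \<omega> = (\<Sum>j<s. vec_index (modulated \<kappa> xs) j * exp (\<i> * complex_of_real (\<kappa> * (\<omega> \<bullet> xs ! j))))" for \<omega>
  have F: "F \<omega> = (\<Sum>j<s. exp (\<i> * complex_of_real (\<kappa> * (\<omega> \<bullet> xs ! j - (xs ! j) $ 3))))" for \<omega>
    unfolding F_def by (intro sum.cong refl)
      (simp add: modulated_def s_def algebra_simps flip: exp_add)
  have cap: "(real s / 2)\<^sup>2 \<le> (cmod (F \<omega>))\<^sup>2" if "\<omega> \<in> polar_cap t" for \<omega>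
  proof -
    have "(\<Sum>j<s. 1 / 2) \<le> (\<Sum>j<s. cos (\<kappa> * (\<omega> \<bullet> xs ! j - (xs ! j) $ 3)))"
    proof (intro sum_mono half_le_cos)
      fix j assume "j \<in> {..<s}"
      then have "xs ! j \<in> set xs" by (simp add: s_def)
      from xs[OF this] polar_cap_phase_le[OF that \<open>0 \<le> \<rho>\<close>, of "xs ! j"]
      have "\<bar>\<omega> \<bullet> xs ! j - (xs ! j) $ 3\<bar> \<le> 2 * t * \<rho> + t\<^sup>2" by blast
      then have "\<kappa> * \<bar>\<omega> \<bullet> xs ! j - (xs ! j) $ 3\<bar> \<le> \<kappa> * (2 * t * \<rho> + t\<^sup>2)"
        using \<open>0 \<le> \<kappa>\<close> by (rule mult_left_mono)
      then show "\<bar>\<kappa> * (\<omega> \<bullet> xs ! j - (xs ! j) $ 3)\<bar> \<le> 1"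
        using phase \<open>0 \<le> \<kappa>\<close> by (simp add: abs_mult)
    qed
    also have "\<dots> = Re (F \<omega>)"
      unfolding F Re_sum by (intro sum.cong refl) (simp only: cis_conv_exp[symmetric] cis.sel)
    also have "\<dots> \<le> cmod (F \<omega>)" by (rule complex_Re_le_cmod)
    finally show ?thesis by (intro power_mono) auto
  qed
  have normF: "cmod (F \<omega>) \<le> real s" for \<omega>
    unfolding F by (rule order_trans[OF norm_sum]) simp
  have "3 * t\<^sup>2 / 16 * (real s / 2)\<^sup>2 \<le> measure sphere_measure (polar_cap t) * (real s / 2)\<^sup>2"
    using measure_polar_cap_ge[OF \<open>0 < t\<close> \<open>t \<le> 1\<close>] by (rule mult_right_mono) simp
  also have "\<dots> = (LINT \<omega>|sphere_measure. (real s / 2)\<^sup>2 * indicator (polar_cap t) \<omega>)"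
    by simp
  also have "\<dots> \<le> (LINT \<omega>|sphere_measure. (cmod (F \<omega>))\<^sup>2)"
  proof (rule integral_mono)
    show "integrable sphere_measure (\<lambda>\<omega>. (real s / 2)\<^sup>2 * indicator (polar_cap t) \<omega>)"
      by (intro integrable_mult_right integrable_real_indicator)
        (simp_all add: finite_measure.emeasure_finite[OF finite_measure_sphere_measure] less_top[symmetric])
    show "integrable sphere_measure (\<lambda>\<omega>. (cmod (F \<omega>))\<^sup>2)"
    proof (rule integrable_sphere_measure)
      show "continuous_on UNIV (\<lambda>\<omega>. (cmod (F \<omega>))\<^sup>2)"
        unfolding F_def by (intro continuous_intros)
      show "norm ((cmod (F \<omega>))\<^sup>2) \<le> (real s)\<^sup>2" for \<omega>
        using normF[of \<omega>] by (simp add: power_mono)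
    qed
    show "(real s / 2)\<^sup>2 * indicator (polar_cap t) \<omega> \<le> (cmod (F \<omega>))\<^sup>2" for \<omega>
      using cap[of \<omega>] by (auto split: split_indicator)
  qed
  finally show ?thesis
    unfolding spherical_energy_def F_def s_def by (simp add: field_simps power2_eq_square)
qed

subsection \<open>The spherical Gram form\<close>

lemma cnj_sphere_kernel: "cnj (sphere_kernel \<kappa> h) = sphere_kernel \<kappa> (- h)"
proof -
  have "cnj (LINT \<omega>|sphere_measure. exp (\<i> * complex_of_real (\<kappa> * (\<omega> \<bullet> h)))) =
      (LINT \<omega>|sphere_measure. cnj (exp (\<i> * complex_of_real (\<kappa> * (\<omega> \<bullet> h)))))"
    by (rule Bochner_Integration.integral_cnj[symmetric])
  then show ?thesis
    unfolding sphere_kernel_def by (simp add: exp_cnj)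
qed

lemma hermitian_mat_spherical_gram: "hermitian_mat (spherical_gram \<kappa> xs) (length xs)"
proof
  fix i j assume "i < length xs" "j < length xs"
  then show "spherical_gram \<kappa> xs $$ (i, j) = cnj (spherical_gram \<kappa> xs $$ (j, i))"
    by (simp add: spherical_gram_def cnj_sphere_kernel)
qed (simp add: spherical_gram_def)

text \<open>The integrand of entry (i, j) factors as e_i times the conjugate of e_j, so the double
  sum is a squared modulus. In it e_i meets the conjugate of the i-th entry of \<open>v\<close>,
  whence \<open>conjugate v\<close> on the right.\<close>

lemma spherical_gram_form:
  assumes v: "v \<in> carrier_vec (length xs)"
  shows "(spherical_gram \<kappa> xs *\<^sub>v v) \<bullet>c v = complex_of_real (spherical_energy \<kappa> xs (conjugate v))"
proof -
  define s where "s = length xs"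
  define e where "e i \<omega> = exp (\<i> * complex_of_real (\<kappa> * (\<omega> \<bullet> xs ! i)))" for i \<omega>
  have int: "integrable sphere_measure
      (\<lambda>\<omega>. exp (\<i> * complex_of_real (\<kappa> * (\<omega> \<bullet> (xs ! i - xs ! j)))) * (vec_index v j * cnj (vec_index v i)))" for i j
    by (intro integrable_mult_left integrable_sphere_exponential)
  have "(spherical_gram \<kappa> xs *\<^sub>v v) \<bullet>c v =
      (\<Sum>i<s. \<Sum>j<s. spherical_gram \<kappa> xs $$ (i, j) * vec_index v j * cnj (vec_index v i))"
    unfolding s_def by (rule sesquilinear_form_sum[OF hermitian_mat.carrier[OF hermitian_mat_spherical_gram] v v])
  also have "\<dots> = (\<Sum>i<s. \<Sum>j<s. 1 / (4 * pi) * (LINT \<omega>|sphere_measure.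
      exp (\<i> * complex_of_real (\<kappa> * (\<omega> \<bullet> (xs ! i - xs ! j)))) * (vec_index v j * cnj (vec_index v i))))"
    by (intro sum.cong refl) (simp add: s_def spherical_gram_def sphere_kernel_def mult_ac)
  also have "\<dots> = 1 / (4 * pi) * (LINT \<omega>|sphere_measure. (\<Sum>i<s. \<Sum>j<s.
      exp (\<i> * complex_of_real (\<kappa> * (\<omega> \<bullet> (xs ! i - xs ! j)))) * (vec_index v j * cnj (vec_index v i))))"
    by (simp only: sum_distrib_left[symmetric] Bochner_Integration.integral_sum int Bochner_Integration.integrable_sum)
  also have "(\<lambda>\<omega>. \<Sum>i<s. \<Sum>j<s.
      exp (\<i> * complex_of_real (\<kappa> * (\<omega> \<bullet> (xs ! i - xs ! j)))) * (vec_index v j * cnj (vec_index v i))) =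
      (\<lambda>\<omega>. complex_of_real ((cmod (\<Sum>i<s. cnj (vec_index v i) * e i \<omega>))\<^sup>2))"
  proof
    fix \<omega>
    have e: "exp (\<i> * complex_of_real (\<kappa> * (\<omega> \<bullet> (xs ! i - xs ! j)))) = e i \<omega> * cnj (e j \<omega>)" for i j
      by (simp add: e_def exp_cnj inner_diff_right algebra_simps flip: exp_add)
    have "(\<Sum>i<s. \<Sum>j<s.
        exp (\<i> * complex_of_real (\<kappa> * (\<omega> \<bullet> (xs ! i - xs ! j)))) * (vec_index v j * cnj (vec_index v i))) =
        (\<Sum>i<s. \<Sum>j<s. (cnj (vec_index v i) * e i \<omega>) * (vec_index v j * cnj (e j \<omega>)))"
      unfolding e by (simp add: mult_ac)
    also have "\<dots> = (\<Sum>i<s. cnj (vec_index v i) * e i \<omega>) * (\<Sum>j<s. vec_index v j * cnj (e j \<omega>))"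
      by (rule sum_product[symmetric])
    also have "\<dots> = complex_of_real ((cmod (\<Sum>i<s. cnj (vec_index v i) * e i \<omega>))\<^sup>2)"
      unfolding complex_norm_square by simp
    finally show "(\<Sum>i<s. \<Sum>j<s.
      exp (\<i> * complex_of_real (\<kappa> * (\<omega> \<bullet> (xs ! i - xs ! j)))) * (vec_index v j * cnj (vec_index v i))) =
      complex_of_real ((cmod (\<Sum>i<s. cnj (vec_index v i) * e i \<omega>))\<^sup>2)" .
  qed
  also have "(LINT \<omega>|sphere_measure. complex_of_real ((cmod (\<Sum>i<s. cnj (vec_index v i) * e i \<omega>))\<^sup>2)) =
      complex_of_real (LINT \<omega>|sphere_measure. (cmod (\<Sum>i<s. cnj (vec_index v i) * e i \<omega>))\<^sup>2)"
    by (rule integral_complex_of_real)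
  also have "complex_of_real (1 / (4 * pi)) * \<dots> = complex_of_real (spherical_energy \<kappa> xs (conjugate v))"
  proof -
    have "(\<Sum>i<s. cnj (vec_index v i) * e i \<omega>) =
        (\<Sum>i<s. vec_index (conjugate v) i * exp (\<i> * complex_of_real (\<kappa> * (\<omega> \<bullet> xs ! i))))" for \<omega>
      using v by (intro sum.cong refl) (simp add: e_def s_def)
    then show ?thesis by (simp add: spherical_energy_def s_def)
  qed
  finally show ?thesis .
qed

text \<open>The Rayleigh bound is applied to \<open>conjugate \<alpha>\<close>, which has the same
  norm as \<open>\<alpha>\<close>. Positivity of the form holds because the energy integrates a
  squared modulus.\<close>

lemma spherical_energy_le_lambda_max:
  assumes \<alpha>: "\<alpha> \<in> carrier_vec (length xs)" and "xs \<noteq> []"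
  shows "spherical_energy \<kappa> xs \<alpha> \<le>
    lambda_max (spherical_gram \<kappa> xs) * (\<Sum>j<length xs. (cmod (vec_index \<alpha> j))\<^sup>2)"
proof -
  have "0 \<le> Re ((spherical_gram \<kappa> xs *\<^sub>v w) \<bullet>c w)" if "w \<in> carrier_vec (length xs)" for w
    by (simp add: spherical_gram_form[OF that] spherical_energy_def)
  moreover have "conjugate \<alpha> \<in> carrier_vec (length xs)" using \<alpha> by simp
  ultimately have "Re ((spherical_gram \<kappa> xs *\<^sub>v conjugate \<alpha>) \<bullet>c conjugate \<alpha>) \<le>
      lambda_max (spherical_gram \<kappa> xs) * (\<Sum>j<length xs. (cmod (vec_index (conjugate \<alpha>) j))\<^sup>2)"
    using \<open>xs \<noteq> []\<close> by (intro hermitian_mat.rayleigh_le_lambda_max[OF hermitian_mat_spherical_gram]) auto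
  then show ?thesis
    unfolding spherical_gram_form[OF \<open>conjugate \<alpha> \<in> carrier_vec (length xs)\<close>] using \<alpha> by simp
qed

subsection \<open>The needle-shaped grid\<close>

text \<open>The shift by 1/2 centres the needle, so that its unit height fits inside the unit
  ball.\<close>

definition grid_point :: "nat \<Rightarrow> nat \<times> nat \<times> nat \<Rightarrow> real ^ 3" where
  "grid_point n = (\<lambda>(a, b, c). vector [real a / real n ^ 4, real b / real n ^ 4, real c / real n ^ 4 - 1 / 2])"

lemma grid_point_nth [simp]:
  "grid_point n (a, b, c) $ 1 = real a / real n ^ 4"
  "grid_point n (a, b, c) $ 2 = real b / real n ^ 4"
  "grid_point n (a, b, c) $ 3 = real c / real n ^ 4 - 1 / 2"
  by (simp_all add: grid_point_def)

text \<open>Distinct index triples differ by at least 1 in some coordinate, and the norm dominates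
  every coordinate.\<close>

lemma norm_diff_grid_point_ge:
  assumes "n > 0" "p \<noteq> q"
  shows "1 / real n ^ 4 \<le> norm (grid_point n p - grid_point n q)"
proof -
  obtain a b c a' b' c' where pq: "p = (a, b, c)" "q = (a', b', c')" by (metis prod_cases3)
  have step: "1 / real n ^ 4 \<le> \<bar>real k / real n ^ 4 - real l / real n ^ 4\<bar>" if "k \<noteq> l" for k l :: nat
  proof -
    have "1 \<le> \<bar>real k - real l\<bar>" using that by linarith
    then have "1 / real n ^ 4 \<le> \<bar>real k - real l\<bar> / real n ^ 4"
      by (rule divide_right_mono) simp
    then show ?thesis by (simp add: abs_divide flip: diff_divide_distrib)
  qed
  let ?d = "grid_point n p - grid_point n q"
  have "1 / real n ^ 4 \<le> \<bar>?d $ 1\<bar> \<or> 1 / real n ^ 4 \<le> \<bar>?d $ 2\<bar> \<or> 1 / real n ^ 4 \<le> \<bar>?d $ 3\<bar>"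
    using assms(2) step[of a a'] step[of b b'] step[of c c'] by (auto simp: pq)
  then show ?thesis using component_le_norm_cart order_trans by blast
qed

lemma inj_grid_point:
  assumes "n > 0"
  shows "inj (grid_point n)"
proof (rule injI, rule ccontr)
  fix p q assume "grid_point n p = grid_point n q" "p \<noteq> q"
  with norm_diff_grid_point_ge[OF assms this(2)] assms show False by simp
qed

definition grid :: "nat \<Rightarrow> (real ^ 3) set" where
  "grid n = grid_point n ` ({..<n} \<times> {..<n} \<times> {..<n ^ 4})"

lemma grid_bounds:
  fixes x :: "real ^ 3"
  assumes "n \<ge> 2" "x \<in> grid n"
  shows "\<bar>x $ 1\<bar> \<le> 1 / real n ^ 3" "\<bar>x $ 2\<bar> \<le> 1 / real n ^ 3" "\<bar>x $ 3\<bar> \<le> 1 / 2" "norm x < 1"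
proof -
  obtain a b c where x: "x = grid_point n (a, b, c)" and abc: "a < n" "b < n" "c < n ^ 4"
    using assms(2) by (auto simp: grid_def)
  have lateral: "real k / real n ^ 4 \<le> 1 / real n ^ 3" if "k < n" for k
  proof -
    have "real k / real n ^ 4 \<le> real n / real n ^ 4" using that by (intro divide_right_mono) auto
    also have "\<dots> = 1 / real n ^ 3" using assms(1) by (simp add: power_def numeral_eq_Suc)
    finally show ?thesis .
  qed
  show x1: "\<bar>x $ 1\<bar> \<le> 1 / real n ^ 3" and x2: "\<bar>x $ 2\<bar> \<le> 1 / real n ^ 3"
    using lateral abc by (simp_all add: x)
  have "real c \<le> real (n ^ 4)" using abc(3) by (simp only: of_nat_le_iff less_imp_le)
  then have "real c / real n ^ 4 \<le> real (n ^ 4) / real n ^ 4" by (rule divide_right_mono) simp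
  also have "\<dots> = 1" using assms(1) by simp
  finally have "real c / real n ^ 4 \<le> 1" .
  moreover have "0 \<le> real c / real n ^ 4" by simp
  ultimately show x3: "\<bar>x $ 3\<bar> \<le> 1 / 2" unfolding x grid_point_nth by linarith
  \<comment> \<open>All three coordinates turn out to be at most 1/2 in absolute value, so the
    squared norm is at most 3/4.\<close>
  have "(2::real) ^ 3 \<le> real n ^ 3" using assms(1) by (intro power_mono) auto
  then have "1 / real n ^ 3 \<le> 1 / 2" using assms(1) by (intro divide_left_mono) auto
  then have "\<bar>x $ 1\<bar> \<le> 1 / 2" "\<bar>x $ 2\<bar> \<le> 1 / 2" using x1 x2 by linarith+
  note power2_norm_3[of x]
  also have "(x $ 1)\<^sup>2 + (x $ 2)\<^sup>2 + (x $ 3)\<^sup>2 \<le> (1 / 2)\<^sup>2 + (1 / 2)\<^sup>2 + (1 / 2)\<^sup>2"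
    using \<open>\<bar>x $ 1\<bar> \<le> 1 / 2\<close> \<open>\<bar>x $ 2\<bar> \<le> 1 / 2\<close> x3
    by (intro add_mono abs_le_square_iff[THEN iffD1]) auto
  also have "\<dots> < 1\<^sup>2" by (simp add: power2_eq_square)
  finally show "norm x < 1" by (rule power2_less_imp_less) simp
qed

lemma grid_cloud:
  assumes "n \<ge> 2"
  obtains xs where "point_cloud xs" "set xs = grid n" "length xs = n ^ 6" "separation xs = 1 / real n ^ 4"
proof -
  have n: "n > 0" using assms by simp
  have "finite (grid n)" by (simp add: grid_def)
  then obtain xs where xs: "set xs = grid n" "distinct xs" using finite_distinct_list by blast
  have "card (grid n) = n * (n * n ^ 4)"
    unfolding grid_def by (subst card_image) (use inj_grid_point[OF n] in \<open>auto intro: inj_on_subset\<close>)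
  also have "\<dots> = n ^ 6" by (simp add: numeral_eq_Suc)
  finally have len: "length xs = n ^ 6" using xs distinct_card by metis
  have cloud: "point_cloud xs"
    unfolding point_cloud_def using xs grid_bounds(4)[OF assms] by auto
  have "separation xs = 1 / real n ^ 4"
    unfolding separation_def
  proof (rule Min_eqI)
    have "{norm (xs ! j - xs ! k) |j k. j < length xs \<and> k < length xs \<and> j \<noteq> k} \<subseteq>
        (\<lambda>(j, k). norm (xs ! j - xs ! k)) ` ({..<length xs} \<times> {..<length xs})" by auto
    then show "finite {norm (xs ! j - xs ! k) |j k. j < length xs \<and> k < length xs \<and> j \<noteq> k}"
      by (rule finite_subset) simp
  next
    fix y assume "y \<in> {norm (xs ! j - xs ! k) |j k. j < length xs \<and> k < length xs \<and> j \<noteq> k}"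
    then obtain j k where y: "y = norm (xs ! j - xs ! k)" and jk: "j < length xs" "k < length xs" "j \<noteq> k" by auto
    have "xs ! j \<noteq> xs ! k" using jk xs(2) by (simp add: nth_eq_iff_index_eq)
    moreover have "xs ! j \<in> grid n" "xs ! k \<in> grid n" using jk xs(1) nth_mem by blast+
    then obtain p q where "xs ! j = grid_point n p" "xs ! k = grid_point n q" unfolding grid_def by blast
    ultimately show "1 / real n ^ 4 \<le> y" using norm_diff_grid_point_ge[OF n, of p q] y by auto
  next
    \<comment> \<open>Two neighbours along the first axis attain the minimum; the index 1 is
      available because n is at least 2.\<close>
    define p q where "p = grid_point n (1, 0, 0)" and "q = grid_point n (0, 0, 0)"
    have "p \<in> set xs" "q \<in> set xs" using assms unfolding xs(1) grid_def p_def q_def by auto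
    then obtain j k where jk: "j < length xs" "k < length xs" "xs ! j = p" "xs ! k = q"
      by (metis in_set_conv_nth)
    have "p - q = (1 / real n ^ 4) *\<^sub>R axis 1 1"
      by (simp add: Finite_Cartesian_Product.vec_eq_iff forall_3 p_def q_def axis_def)
    then have "norm (p - q) = 1 / real n ^ 4" by simp
    moreover have "p - q \<noteq> 0" using calculation n by auto
    then have "j \<noteq> k" using jk by auto
    ultimately show "1 / real n ^ 4 \<in> {norm (xs ! j - xs ! k) |j k. j < length xs \<and> k < length xs \<and> j \<noteq> k}"
      using jk by (metis (mono_tags, lifting) mem_Collect_eq)
  qed
  then show thesis using that cloud xs(1) len by blast
qed

section \<open>Spectral lower bound for the grid and failure of the frame bound\<close>

lemma modulated_props [simp]:
  "modulated \<kappa> xs \<in> carrier_vec (length xs)"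
  "j < length xs \<Longrightarrow> cmod (vec_index (modulated \<kappa> xs) j) = 1"
  by (simp_all add: modulated_def)

lemma spherical_energy_grid_ge:
  assumes "n \<ge> 2" "0 < \<epsilon>" "\<epsilon> \<le> 1" "1 \<le> \<epsilon> * real n ^ 6"
    and xs: "set xs = grid n" "length xs = n ^ 6"
  shows "3 / (4096 * pi) / \<epsilon> * real (n ^ 6) \<le>
    spherical_energy (\<epsilon> * real n ^ 6) xs (modulated (\<epsilon> * real n ^ 6) xs)"
proof -
  have n: "real n > 0" using assms by simp
  define N where "N = real n ^ 3"
  \<comment> \<open>This is 1 / (4 sqrt \<kappa>) for \<kappa> = \<epsilon> n^6. The quadratic phase
    \<kappa> t^2 becomes 1/16, and the lateral phase 2 \<kappa> t / n^3 becomes (sqrt \<epsilon>)/2,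
    at most 1/2 because \<epsilon> \<le> 1.\<close>
  define t where "t = 1 / (4 * sqrt \<epsilon> * N)"
  have N: "N > 0" using n by (simp add: N_def)
  have n6: "real n ^ 6 = N\<^sup>2" by (simp add: N_def flip: power_mult)
  have t: "t > 0" using N assms by (simp add: t_def)
  have t2: "t\<^sup>2 = 1 / (16 * \<epsilon> * real n ^ 6)"
    unfolding t_def n6 using assms(2) by (simp add: power_divide power_mult_distrib)
  have "t\<^sup>2 \<le> 1\<^sup>2" unfolding t2 using assms by simp
  then have "t \<le> 1" by (rule power2_le_imp_le) simp
  have "\<epsilon> * real n ^ 6 * (2 * t * (1 / real n ^ 3)) = \<epsilon> / sqrt \<epsilon> / 2"
    unfolding n6 t_def N_def[symmetric] using N by (simp add: power2_eq_square)
  also have "\<dots> = sqrt \<epsilon> / 2" using assms by (simp add: real_div_sqrt)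
  also have "\<dots> \<le> 1 / 2" using assms by simp
  finally have "\<epsilon> * real n ^ 6 * (2 * t * (1 / real n ^ 3)) \<le> 1 / 2" .
  moreover have "\<epsilon> * real n ^ 6 * t\<^sup>2 = 1 / 16" unfolding t2 using n assms by simp
  ultimately have phase: "\<epsilon> * real n ^ 6 * (2 * t * (1 / real n ^ 3) + t\<^sup>2) \<le> 1"
    unfolding distrib_left by linarith
  have "3 * t\<^sup>2 * real (length xs) ^ 2 / (256 * pi) \<le>
      spherical_energy (\<epsilon> * real n ^ 6) xs (modulated (\<epsilon> * real n ^ 6) xs)"
    by (rule spherical_energy_modulated_ge[OF _ _ t \<open>t \<le> 1\<close> _ phase])
      (use grid_bounds[OF \<open>n \<ge> 2\<close>] xs assms in auto)
  \<comment> \<open>The factor n^6 in the denominator of t^2 cancels one of the two factors s = n^6,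
    and 16 * 256 = 4096.\<close>
  moreover have "3 * t\<^sup>2 * real (length xs) ^ 2 / (256 * pi) = 3 / (4096 * pi) / \<epsilon> * real (n ^ 6)"
    unfolding t2 xs(2) using n assms by (simp add: field_simps power2_eq_square)
  ultimately show ?thesis by simp
qed

lemma root3_power6: "real (n ^ 6) powr (1 / 3) = real n ^ 2"
proof -
  have "real (n ^ 6) = real n powr 6" by simp
  then have "real (n ^ 6) powr (1 / 3) = (real n powr 6) powr (1 / 3)" by (rule arg_cong)
  also have "\<dots> = real n powr (6 * (1 / 3))" by (rule powr_powr)
  also have "\<dots> = real n ^ 2" by simp
  finally show ?thesis .
qed

lemma eventually_scale_large:
  assumes "\<epsilon> > 0"
  shows "\<forall>\<^sub>F n in sequentially. 1 \<le> \<epsilon> * real n ^ 6"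
proof -
  have "filterlim (\<lambda>n. \<epsilon> * real n ^ 6) at_top sequentially"
    by (intro filterlim_tendsto_pos_mult_at_top[OF tendsto_const assms] filterlim_pow_at_top
        filterlim_real_sequentially) simp
  then show ?thesis by (simp add: filterlim_at_top)
qed

lemma lambda_max_grid_ge:
  assumes "n \<ge> 2" "0 < \<epsilon>" "\<epsilon> \<le> 1" "1 \<le> \<epsilon> * real n ^ 6"
    and xs: "set xs = grid n" "length xs = n ^ 6"
  shows "3 / (4096 * pi) / \<epsilon> \<le> lambda_max (spherical_gram (\<epsilon> * real n ^ 6) xs)"
proof -
  have "xs \<noteq> []" using assms by auto
  have "3 / (4096 * pi) / \<epsilon> * real (n ^ 6) \<le> lambda_max (spherical_gram (\<epsilon> * real n ^ 6) xs) *
      (\<Sum>j<length xs. (cmod (vec_index (modulated (\<epsilon> * real n ^ 6) xs) j))\<^sup>2)"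
    using spherical_energy_grid_ge[OF assms]
      spherical_energy_le_lambda_max[OF modulated_props(1) \<open>xs \<noteq> []\<close>] by (rule order_trans)
  also have "(\<Sum>j<length xs. (cmod (vec_index (modulated (\<epsilon> * real n ^ 6) xs) j))\<^sup>2) = real (n ^ 6)"
    by (simp add: xs(2))
  finally show ?thesis
    by (rule mult_right_le_imp_le) (use \<open>n \<ge> 2\<close> in simp)
qed

text \<open>For given \<open>C\<close>, \<epsilon> is fixed so small that the energy per unit norm
  on the grid exceeds \<open>C\<close>. The little-o hypothesis with this \<epsilon> yields \<tau>
  (n^6) \<le> \<epsilon> n^2 for large n, which is exactly the scaled separation of the grid, so the
  grid is an admissible counterexample.\<close>

lemma no_frame_upper_bound_below_cube_root:
  assumes "\<tau> \<in> o(\<lambda>s. real s powr (1 / 3))"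
  shows "\<not> arbitrary_cloud_frame_upper_bound \<tau> C"
proof
  assume bound: "arbitrary_cloud_frame_upper_bound \<tau> C"
  define c where "c = 3 / (4096 * pi)"
  \<comment> \<open>\<open>C\<close> may have any sign; the absolute value plus 1 gives a positive
    denominator and the strict inequality C < c / \<epsilon>. The cap at 1 is what the grid estimate
    requires.\<close>
  define \<epsilon> where "\<epsilon> = min 1 (c / (\<bar>C\<bar> + 1))"
  have "c > 0" by (simp add: c_def)
  then have \<epsilon>: "0 < \<epsilon>" "\<epsilon> \<le> 1" "\<epsilon> \<le> c / (\<bar>C\<bar> + 1)" by (auto simp: \<epsilon>_def)
  have "C < c / \<epsilon>"
  proof -
    have "\<epsilon> * (\<bar>C\<bar> + 1) \<le> c" using \<epsilon>(3) by (simp add: field_simps)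
    then have "\<bar>C\<bar> + 1 \<le> c / \<epsilon>" using \<epsilon>(1) by (simp add: field_simps)
    then show ?thesis by linarith
  qed
  have "\<forall>\<^sub>F s in sequentially. norm (\<tau> s) \<le> \<epsilon> * norm (real s powr (1 / 3))"
    using landau_o.smallD[OF assms \<epsilon>(1)] .
  \<comment> \<open>The asymptotic bound in s is restricted to the cardinalities s = n^6 that the
    grids realise.\<close>
  moreover have "filterlim (\<lambda>n :: nat. n ^ 6) at_top sequentially"
    by (rule filterlim_subseq) (auto simp: strict_mono_def intro: power_strict_mono)
  ultimately have "\<forall>\<^sub>F n in sequentially. norm (\<tau> (n ^ 6)) \<le> \<epsilon> * norm (real (n ^ 6) powr (1 / 3))"
    using eventually_compose_filterlim by blast
  then have "\<forall>\<^sub>F n in sequentially. norm (\<tau> (n ^ 6)) \<le> \<epsilon> * norm (real (n ^ 6) powr (1 / 3)) \<and>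
      1 \<le> \<epsilon> * real n ^ 6 \<and> n \<ge> 2"
    using eventually_scale_large[OF \<epsilon>(1)] eventually_ge_at_top[of 2] by eventually_elim simp
  then obtain n where n: "norm (\<tau> (n ^ 6)) \<le> \<epsilon> * norm (real (n ^ 6) powr (1 / 3))"
      "1 \<le> \<epsilon> * real n ^ 6" "n \<ge> 2"
    using eventually_happens'[OF sequentially_bot] by blast
  obtain xs where xs: "point_cloud xs" "set xs = grid n" "length xs = n ^ 6" "separation xs = 1 / real n ^ 4"
    using grid_cloud[OF n(3)] .
  define \<kappa> where "\<kappa> = \<epsilon> * real n ^ 6"
  have "\<tau> (length xs) \<le> \<epsilon> * real n ^ 2"
    using n(1) unfolding root3_power6 xs(3) by simp
  also have "\<dots> = \<kappa> * separation xs"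
    using n(3) by (simp add: \<kappa>_def xs(4) numeral_eq_Suc)
  finally have "\<tau> (length xs) \<le> \<kappa> * separation xs" .
  moreover have "2 \<le> length xs"
    using n(3) self_le_power[of n 6] xs(3) by linarith
  moreover have "\<kappa> > 0" using \<epsilon> n by (simp add: \<kappa>_def)
  ultimately have "spherical_energy \<kappa> xs (modulated \<kappa> xs) \<le>
      C * (\<Sum>j<length xs. (cmod (vec_index (modulated \<kappa> xs) j))\<^sup>2)"
    using bound xs(1) modulated_props(1) unfolding arbitrary_cloud_frame_upper_bound_def by blast
  also have "\<dots> = C * real (n ^ 6)" by (simp add: xs(3))
  also have "\<dots> < c / \<epsilon> * real (n ^ 6)"
    using \<open>C < c / \<epsilon>\<close> n(3) by (intro mult_strict_right_mono) auto
  also have "\<dots> \<le> spherical_energy \<kappa> xs (modulated \<kappa> xs)"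
    unfolding c_def \<kappa>_def by (rule spherical_energy_grid_ge[OF n(3) \<epsilon>(1,2) n(2) xs(2,3)])
  finally show False by simp
qed

theorem propositionC1:
  shows "(\<exists>c\<^sub>0 > 0. \<exists>\<epsilon>\<^sub>0 > 0. \<forall>\<epsilon>::real. 0 < \<epsilon> \<and> \<epsilon> \<le> \<epsilon>\<^sub>0 \<longrightarrow>
           (\<forall>\<^sub>F n::nat in sequentially. \<exists>xs \<kappa>.
              point_cloud xs \<and>
              length xs = n ^ 6 \<and>
              separation xs = 1 / real n ^ 4 \<and>
              \<kappa> = \<epsilon> * real n ^ 6 \<and>
              \<kappa> * separation xs = \<epsilon> * real n ^ 2 \<and>
              \<epsilon> * real n ^ 2 = \<epsilon> * real (length xs) powr (1 / 3) \<and>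
              lambda_max (spherical_gram \<kappa> xs) \<ge> c\<^sub>0 / \<epsilon>)) \<and>
         (\<forall>\<tau>::nat \<Rightarrow> real. \<tau> \<in> o(\<lambda>s. real s powr (1 / 3)) \<longrightarrow>
           \<not> (\<exists>C. arbitrary_cloud_frame_upper_bound \<tau> C))"
proof (intro conjI exI allI impI)
  \<comment> \<open>The witnesses left open by \<open>exI\<close> are fixed here:
    \<open>\<epsilon>\<^sub>0\<close> is 1 and \<open>c\<^sub>0\<close> is
    \<open>3 / (4096 * pi)\<close>.\<close>
  fix \<epsilon> :: real assume \<epsilon>: "0 < \<epsilon> \<and> \<epsilon> \<le> 1"
  show "\<forall>\<^sub>F n::nat in sequentially. \<exists>xs \<kappa>.
      point_cloud xs \<and>
      length xs = n ^ 6 \<and>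
      separation xs = 1 / real n ^ 4 \<and>
      \<kappa> = \<epsilon> * real n ^ 6 \<and>
      \<kappa> * separation xs = \<epsilon> * real n ^ 2 \<and>
      \<epsilon> * real n ^ 2 = \<epsilon> * real (length xs) powr (1 / 3) \<and>
      lambda_max (spherical_gram \<kappa> xs) \<ge> (3 / (4096 * pi)) / \<epsilon>"
    using eventually_scale_large[OF conjunct1[OF \<epsilon>]] eventually_ge_at_top[of 2]
  proof eventually_elim
    case (elim n)
    obtain xs where xs: "point_cloud xs" "set xs = grid n" "length xs = n ^ 6" "separation xs = 1 / real n ^ 4"
      using grid_cloud[OF elim(2)] .
    have "\<epsilon> * real n ^ 6 * separation xs = \<epsilon> * real n ^ 2"
      using elim(2) by (simp add: xs(4) numeral_eq_Suc)
    then show ?case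
      using xs lambda_max_grid_ge[OF elim(2) _ _ elim(1) xs(2,3)] \<epsilon> root3_power6[of n]
      by (intro exI[of _ xs] exI[of _ "\<epsilon> * real n ^ 6"] conjI) auto
  qed
next
  fix \<tau> :: "nat \<Rightarrow> real" assume "\<tau> \<in> o(\<lambda>s. real s powr (1 / 3))"
  then show "\<not> (\<exists>C. arbitrary_cloud_frame_upper_bound \<tau> C)"
    using no_frame_upper_bound_below_cube_root by blast
qed simp_all

end
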